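(* Fix a sample $i$ and an index $j\in\{1,\ldots,N\}$, and let $\tilde T_i$, $e_{i,j}$, $e'_{i,j}$, $d_{i,j}=e'_{i,j}-e_{i,j}$, $\mathcal L_{\mathrm{sal}}$, $\psi_{i,j}$, $\mathrm{CEff}_{i,j}^{\mathrm{exact}}$, $a_{i,j}$ and $\mathrm{TE}_{i,j}$ be as defined in the context, where $\psi_{i,j}$ is differentiable at $e_{i,j}$. Then $$|a_{i,j}|\le \mathrm{TE}_{i,j}.$$ Moreover, let $\Omega_{i,j}=\{\,e_{i,j}+\alpha\, d_{i,j}:\alpha\in[0,1]\,\}\subset\mathbb R^C$, and assume that $\psi_{i,j}$ is twice continuously differentiable on a neighborhood of $\Omega_{i,j}$ and that $\sup_{v\in\Omega_{i,j}}\|\nabla^2\psi_{i,j}(v)\|_{\mathrm{op}}\le H_{i,j}$ for some constant $H_{i,j}$. Then $$\big|\mathrm{CEff}_{i,j}^{\mathrm{exact}}\big|\le \mathrm{TE}_{i,j}+\frac{H_{i,j}}{2}\,\|d_{i,j}\|_2^2.$$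
   Context: Let $C,N,K\ge 1$ be integers. For a sample $i$, let $\tilde T_i=[\,e_{[\mathtt{CLS}]};e_{i,1},\ldots,e_{i,N}\,]\in\mathbb R^{(N+1)\times C}$ be a sequence of vectors in $\mathbb R^C$: a special vector $e_{[\mathtt{CLS}]}$ followed by $N$ "evidence units" $e_{i,1},\ldots,e_{i,N}$. A model (Transformer followed by a classifier) is a function assigning to each sequence $T\in\mathbb R^{(N+1)\times C}$ a logit vector $z(T)=(z_1(T),\ldots,z_K(T))\in\mathbb R^K$. The predicted class $\hat y_i\in\arg\max_k z_k(\tilde T_i)$ is determined once from the sequence $\tilde T_i$ and then held constant (under replacement of units and under differentiation). The saliency objective is $\mathcal L_{\mathrm{sal}}(T)=-z_{\hat y_i}(T)$ for every $T\in\mathbb R^{(N+1)\times C}$. For $j\in\{1,\ldots,N\}$ and $v\in\mathbb R^C$, $\tilde T_i^{(j\leftarrow v)}$ denotes the sequence obtained from $\tilde T_i$ by replacing the unit $e_{i,j}$ with $v$ and leaving all other entries (including $e_{[\mathtt{CLS}]}$) unchanged. Define $\psi_{i,j}:\mathbb R^C\to\mathbb R$ by $\psi_{i,j}(v)=\mathcal L_{\mathrm{sal}}(\tilde T_i^{(j\leftarrow v)})$. Let $e'_{i,j}\in\mathbb R^C$ be a reference vector (the choice used in applications is $e'_{i,j}=\mathbf 0$), and let $d_{i,j}=e'_{i,j}-e_{i,j}$ be the replacement direction, with coordinates $d_{i,j,c}$, $c=1,\ldots,C$. The exact counterfactual effect of unit $j$ is $$\mathrm{CEff}_{i,j}^{\mathrm{exact}}=\mathcal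 L_{\mathrm{sal}}\big(\tilde T_i^{(j\leftarrow e'_{i,j})}\big)-\mathcal L_{\mathrm{sal}}(\tilde T_i)=\psi_{i,j}(e'_{i,j})-\psi_{i,j}(e_{i,j}).$$ The signed first-order term is $$a_{i,j}=\big\langle\nabla_{e_{i,j}}\mathcal L_{\mathrm{sal}}(\tilde T_i),\,d_{i,j}\big\rangle=\sum_{c=1}^{C}\frac{\partial\mathcal L_{\mathrm{sal}}(\tilde T_i)}{\partial e_{i,j,c}}\,d_{i,j,c},$$ where $\nabla_{e_{i,j}}\mathcal L_{\mathrm{sal}}(\tilde T_i)=\nabla\psi_{i,j}(e_{i,j})$ and $\langle\cdot,\cdot\rangle$ is the Euclidean inner product. The Taylor evidence score is $$\mathrm{TE}_{i,j}=\sum_{c=1}^{C}\left|\frac{\partial\mathcal L_{\mathrm{sal}}(\tilde T_i)}{\partial e_{i,j,c}}\,d_{i,j,c}\right|=\big\|\nabla_{e_{i,j}}\mathcal L_{\mathrm{sal}}(\tilde T_i)\odot d_{i,j}\big\|_1,$$ where $\odot$ is the coordinatewise product. (In the implementation a stop-gradient operator is applied to this quantity; it acts as the identity on values and so does not affect the numerical value of $\mathrm{TE}_{i,j}$.) $\|\cdot\|_2$ is the Euclidean norm, $\|\cdot\|_1$ the $\ell_1$ norm, and $\|\cdot\|_{\mathrm{op}}$ the spectral (operator) norm of a matrix. *)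

theory Defs
  imports "HOL-Analysis.Analysis"
begin

text \<open>Sequences of \<open>N + 1\<close> vectors in \<open>\<real>\<^sup>C\<close>: \<open>C = CARD('c)\<close>, \<open>N = CARD('n)\<close>; row \<open>None\<close> is the
  \<open>[CLS]\<close> vector and row \<open>Some j\<close> is the evidence unit with index \<open>j\<close>.\<close>

type_synonym ('c, 'n) evidence_seq = "((real, 'c) vec, 'n option) vec"

definition partial_deriv :: "'c::finite \<Rightarrow> (real ^ 'c \<Rightarrow> real) \<Rightarrow> real ^ 'c \<Rightarrow> real" where
  "partial_deriv c f x = deriv (\<lambda>t. f (x + t *\<^sub>R axis c 1)) 0"

definition gradient :: "(real ^ 'c::finite \<Rightarrow> real) \<Rightarrow> real ^ 'c \<Rightarrow> real ^ 'c" where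
  "gradient f x = (\<chi> c. partial_deriv c f x)"

definition hessian :: "(real ^ 'c::finite \<Rightarrow> real) \<Rightarrow> real ^ 'c \<Rightarrow> real ^ 'c ^ 'c" where
  "hessian f x = (\<chi> a b. partial_deriv b (partial_deriv a f) x)"

text \<open>Intended for open \<open>U\<close>. Differentiability is in the Frechet sense, so that \<open>gradient\<close> and
  \<open>hessian\<close> do represent the first and second derivatives on \<open>U\<close>.\<close>

definition twice_continuously_differentiable_on ::
    "(real ^ 'c::finite \<Rightarrow> real) \<Rightarrow> (real ^ 'c) set \<Rightarrow> bool" where
  "twice_continuously_differentiable_on f U \<longleftrightarrow>
     (\<forall>x\<in>U. f differentiable (at x)) \<and>
     (\<forall>x\<in>U. gradient f differentiable (at x)) \<and>
     continuous_on U (hessian f)"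

definition spectral_norm :: "real ^ 'c::finite ^ 'c \<Rightarrow> real" where
  "spectral_norm A = onorm (\<lambda>x. A *v x)"

definition replace_unit ::
    "('c::finite, 'n::finite) evidence_seq \<Rightarrow> 'n \<Rightarrow> real ^ 'c \<Rightarrow> ('c, 'n) evidence_seq" where
  "replace_unit T j v = (\<chi> p. if p = Some j then v else T $ p)"

definition saliency_loss ::
    "(('c::finite, 'n::finite) evidence_seq \<Rightarrow> real ^ 'k::finite) \<Rightarrow> 'k \<Rightarrow>
     ('c, 'n) evidence_seq \<Rightarrow> real" where
  "saliency_loss z y S = - (z S $ y)"

definition unit_loss ::
    "(('c::finite, 'n::finite) evidence_seq \<Rightarrow> real ^ 'k::finite) \<Rightarrow> 'k \<Rightarrow>
     ('c, 'n) evidence_seq \<Rightarrow> 'n \<Rightarrow> real ^ 'c \<Rightarrow> real" where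
  "unit_loss z y T j v = saliency_loss z y (replace_unit T j v)"

definition direction ::
    "('c::finite, 'n::finite) evidence_seq \<Rightarrow> 'n \<Rightarrow> real ^ 'c \<Rightarrow> real ^ 'c" where
  "direction T j e' = e' - T $ Some j"

definition ceff_exact ::
    "(('c::finite, 'n::finite) evidence_seq \<Rightarrow> real ^ 'k::finite) \<Rightarrow> 'k \<Rightarrow>
     ('c, 'n) evidence_seq \<Rightarrow> 'n \<Rightarrow> real ^ 'c \<Rightarrow> real" where
  "ceff_exact z y T j e' = saliency_loss z y (replace_unit T j e') - saliency_loss z y T"

definition first_order_term ::
    "(('c::finite, 'n::finite) evidence_seq \<Rightarrow> real ^ 'k::finite) \<Rightarrow> 'k \<Rightarrow>
     ('c, 'n) evidence_seq \<Rightarrow> 'n \<Rightarrow> real ^ 'c \<Rightarrow> real" where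
  "first_order_term z y T j e' = gradient (unit_loss z y T j) (T $ Some j) \<bullet> direction T j e'"

definition taylor_evidence ::
    "(('c::finite, 'n::finite) evidence_seq \<Rightarrow> real ^ 'k::finite) \<Rightarrow> 'k \<Rightarrow>
     ('c, 'n) evidence_seq \<Rightarrow> 'n \<Rightarrow> real ^ 'c \<Rightarrow> real" where
  "taylor_evidence z y T j e' =
     (\<Sum>c\<in>UNIV. \<bar>gradient (unit_loss z y T j) (T $ Some j) $ c * direction T j e' $ c\<bar>)"

definition replacement_segment ::
    "('c::finite, 'n::finite) evidence_seq \<Rightarrow> 'n \<Rightarrow> real ^ 'c \<Rightarrow> (real ^ 'c) set" where
  "replacement_segment T j e' = {T $ Some j + \<alpha> *\<^sub>R direction T j e' |\<alpha>. \<alpha> \<in> {0..1}}"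

end

theory Submission
  imports Defs
begin

text \<open>Restricted to the segment from \<open>e\<close> to \<open>e + d\<close>, the loss is a function \<open>g\<close> of one real variable
  with \<open>g'(0) = a\<close> and \<open>g''(t) = d \<bullet> (H(e + t d) d)\<close>. Taylor's theorem with Lagrange remainder
  gives \<open>g(1) - g(0) = a + g''(t) / 2\<close> for some \<open>t\<close>, where the second term is controlled by
  Cauchy-Schwarz and the spectral norm, and \<open>\<bar>a\<bar>\<close> by the triangle inequality.\<close>

text \<open>\<open>gradient\<close> is assembled from \<open>deriv\<close> along coordinate lines,
  so by itself it says nothing about the full derivative. Frechet differentiability closes the gap:
  the chain rule on each line identifies the partials with \<open>f' (axis c 1)\<close>, and
  linearity of \<open>f'\<close> recovers it from these values.\<close>

lemma has_derivative_gradient: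
  fixes f :: "real ^ 'c::finite \<Rightarrow> real"
  assumes "f differentiable (at x)"
  shows "(f has_derivative (\<lambda>h. gradient f x \<bullet> h)) (at x)"
proof -
  obtain f' where f': "(f has_derivative f') (at x)"
    using assms unfolding differentiable_def by blast
  have lin: "linear f'"
    using f' by (rule has_derivative_linear)
  have partial: "partial_deriv c f x = f' (axis c 1)" for c
  proof -
    have line: "((\<lambda>t::real. x + t *\<^sub>R axis c 1) has_derivative (\<lambda>t. t *\<^sub>R axis c 1)) (at 0)"
      by (auto intro!: derivative_eq_intros)
    have "((\<lambda>t. f (x + t *\<^sub>R axis c 1)) has_derivative (\<lambda>t. f' (t *\<^sub>R axis c 1))) (at 0)"
      using has_derivative_compose[OF line, of f f'] f' by simp
    then have "((\<lambda>t. f (x + t *\<^sub>R axis c 1)) has_field_derivative f' (axis c 1)) (at 0)"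
      by (simp add: has_field_derivative_def linear_cmul[OF lin] mult_commute_abs)
    then show ?thesis
      unfolding partial_deriv_def by (rule DERIV_imp_deriv)
  qed
  have "f' h = gradient f x \<bullet> h" for h
  proof -
    have "f' h = f' (\<Sum>c\<in>UNIV. h $ c *\<^sub>R axis c 1)"
      by (simp add: basis_expansion flip: scalar_mult_eq_scaleR)
    also have "\<dots> = (\<Sum>c\<in>UNIV. h $ c * f' (axis c 1))"
      by (simp add: linear_sum[OF lin] linear_cmul[OF lin])
    finally show ?thesis
      by (simp add: inner_vec_def gradient_def partial mult.commute)
  qed
  then have "f' = (\<lambda>h. gradient f x \<bullet> h)"
    by blast
  with f' show ?thesis
    by simp
qed

text \<open>Row \<open>a\<close> of the Hessian is the gradient of \<open>partial_deriv a f\<close>,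
  which is a component of the differentiable map \<open>gradient f\<close>; the gradient lemma
  therefore applies row by row.\<close>

lemma has_derivative_hessian:
  fixes f :: "real ^ 'c::finite \<Rightarrow> real"
  assumes "gradient f differentiable (at x)"
  shows "(gradient f has_derivative (\<lambda>h. hessian f x *v h)) (at x)"
proof -
  obtain G where G: "(gradient f has_derivative G) (at x)"
    using assms unfolding differentiable_def by blast
  have "(partial_deriv a f has_derivative (\<lambda>h. (hessian f x *v h) $ a)) (at x)" for a
  proof -
    have "((\<lambda>u. gradient f u $ a) has_derivative (\<lambda>h. G h $ a)) (at x)"
      using bounded_linear.has_derivative[OF bounded_linear_vec_nth G] .
    then have "partial_deriv a f differentiable (at x)"
      by (auto simp: gradient_def differentiable_def)
    from has_derivative_gradient[OF this] show ?thesis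
      by (simp add: gradient_def hessian_def matrix_vector_mult_def inner_vec_def)
  qed
  then have "((\<lambda>u. \<chi> a. partial_deriv a f u) has_derivative (\<lambda>h. \<chi> a. (hessian f x *v h) $ a)) (at x)"
    by (subst has_derivative_componentwise_within)
       (auto simp: Basis_vec_def inner_axis)
  moreover have "gradient f = (\<lambda>u. \<chi> a. partial_deriv a f u)"
    by (simp add: fun_eq_iff gradient_def)
  ultimately show ?thesis
    by simp
qed

lemma spectral_norm_quadratic_form:
  fixes A :: "real ^ 'c::finite ^ 'c"
  shows "\<bar>d \<bullet> (A *v d)\<bar> \<le> spectral_norm A * (norm d)\<^sup>2"
proof -
  have "\<bar>d \<bullet> (A *v d)\<bar> \<le> norm d * norm (A *v d)"
    by (rule Cauchy_Schwarz_ineq2)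
  also have "\<dots> \<le> norm d * (spectral_norm A * norm d)"
    unfolding spectral_norm_def
    by (intro mult_left_mono onorm matrix_vector_mul_bounded_linear) simp
  finally show ?thesis
    by (simp add: power2_eq_square mult_ac)
qed

text \<open>The sum of the absolute entries dominates the operator norm and is visibly continuous in
  \<open>v\<close>, so its maximum on a compact set serves as the bound.\<close>

lemma bdd_above_spectral_norm:
  fixes A :: "'a::topological_space \<Rightarrow> real ^ 'c::finite ^ 'c"
  assumes "compact S" "continuous_on S A"
  shows "bdd_above ((\<lambda>v. spectral_norm (A v)) ` S)"
proof -
  have "continuous_on S (\<lambda>v. \<Sum>a\<in>UNIV. \<Sum>b\<in>UNIV. \<bar>A v $ a $ b\<bar>)"
    using assms(2) by (intro continuous_intros)
  then have "bdd_above ((\<lambda>v. \<Sum>a\<in>UNIV. \<Sum>b\<in>UNIV. \<bar>A v $ a $ b\<bar>) ` S)"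
    using assms(1) by (intro bounded_imp_bdd_above compact_imp_bounded compact_continuous_image)
  then obtain M where M: "\<And>v. v \<in> S \<Longrightarrow> (\<Sum>a\<in>UNIV. \<Sum>b\<in>UNIV. \<bar>A v $ a $ b\<bar>) \<le> M"
    by (auto simp: bdd_above_def)
  show ?thesis
    unfolding spectral_norm_def
    by (rule bdd_aboveI2[where M = M]) (rule order_trans[OF onorm_le_matrix_component_sum M])
qed

lemma first_order_taylor_bound:
  fixes f :: "real ^ 'c::finite \<Rightarrow> real"
  assumes "twice_continuously_differentiable_on f U"
    and seg: "\<And>t. t \<in> {0..1} \<Longrightarrow> x + t *\<^sub>R d \<in> U"
    and H: "\<And>t. t \<in> {0..1} \<Longrightarrow> spectral_norm (hessian f (x + t *\<^sub>R d)) \<le> H"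
  shows "\<bar>f (x + d) - f x - gradient f x \<bullet> d\<bar> \<le> H / 2 * (norm d)\<^sup>2"
proof -
  define p where "p t = x + t *\<^sub>R d" for t :: real
  \<comment> \<open>The successive derivatives along the segment, in the indexed form that
    \<open>Maclaurin\<close> expects; only the orders 0, 1 and 2 matter.\<close>
  define D where "D = (\<lambda>m::nat. if m = 0 then (\<lambda>t. f (p t))
    else if m = 1 then (\<lambda>t. gradient f (p t) \<bullet> d)
    else (\<lambda>t. d \<bullet> (hessian f (p t) *v d)))"
  have p: "(p has_derivative (\<lambda>s. s *\<^sub>R d)) (at t)" for t
    unfolding p_def by (auto intro!: derivative_eq_intros)
  \<comment> \<open>These derivatives are two-sided even at \<open>t = 0\<close> and
    \<open>t = 1\<close>, as \<open>Maclaurin\<close> demands: \<open>f\<close> and its gradient are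
    differentiable in the full space at every point of \<open>U\<close>.\<close>
  have D1: "((\<lambda>t. f (p t)) has_field_derivative gradient f (p t) \<bullet> d) (at t)"
    and D2: "((\<lambda>t. gradient f (p t) \<bullet> d) has_field_derivative d \<bullet> (hessian f (p t) *v d)) (at t)"
    if "t \<in> {0..1}" for t
  proof -
    have fd: "f differentiable (at (p t))" and gd: "gradient f differentiable (at (p t))"
      using assms(1) seg[OF that] by (auto simp: twice_continuously_differentiable_on_def p_def)
    show "((\<lambda>t. f (p t)) has_field_derivative gradient f (p t) \<bullet> d) (at t)"
      using has_derivative_compose[OF p has_derivative_gradient[OF fd]]
      by (simp add: has_field_derivative_def mult_commute_abs)
    have "((\<lambda>t. gradient f (p t) \<bullet> d) has_derivative (\<lambda>s. (hessian f (p t) *v (s *\<^sub>R d)) \<bullet> d)) (at t)"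
      using has_derivative_compose[OF p has_derivative_hessian[OF gd]]
      by (rule has_derivative_inner_left)
    then show "((\<lambda>t. gradient f (p t) \<bullet> d) has_field_derivative d \<bullet> (hessian f (p t) *v d)) (at t)"
      by (simp add: has_field_derivative_def matrix_vector_mult_scaleR inner_commute[of d] mult_commute_abs)
  qed
  have "\<forall>m t. m < 2 \<and> 0 \<le> t \<and> t \<le> 1 \<longrightarrow> DERIV (D m) t :> D (Suc m) t"
    using D1 D2 by (auto simp: D_def less_2_cases_iff)
  then obtain t where t: "0 < t" "t < 1"
    and eq: "D 0 1 = (\<Sum>m<2. D m 0 / fact m * 1 ^ m) + D 2 t / fact 2 * 1 ^ 2"
    using Maclaurin[of 1 2 D "D 0"] by auto
  have "f (x + d) - f x - gradient f x \<bullet> d = d \<bullet> (hessian f (p t) *v d) / 2"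
    using eq by (simp add: D_def p_def numeral_2_eq_2)
  moreover have "\<bar>d \<bullet> (hessian f (p t) *v d)\<bar> \<le> H * (norm d)\<^sup>2"
    using spectral_norm_quadratic_form[of d "hessian f (p t)"] H[of t] t
    by (smt (verit) atLeastAtMost_iff mult_right_mono p_def zero_le_power2)
  ultimately show ?thesis
    by linarith
qed

lemma abs_first_order_term_le:
  "\<bar>first_order_term z y T j e'\<bar> \<le> taylor_evidence z y T j e'"
  unfolding first_order_term_def taylor_evidence_def inner_vec_def
  by (simp add: sum_abs)

text \<open>The class \<open>y\<close> is a fixed argument, chosen at \<open>T\<close>, so neither
  replacing the unit nor differentiating changes which logit is read.\<close>

theorem corollary1:
  fixes z :: "('c::finite, 'n::finite) evidence_seq \<Rightarrow> real ^ 'k::finite"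
    and T :: "('c, 'n) evidence_seq"
    and y :: 'k
    and j :: 'n
    and e' :: "real ^ 'c"
  assumes predicted: "is_arg_max (\<lambda>k. z T $ k) (\<lambda>_. True) y"
    and diff: "unit_loss z y T j differentiable (at (T $ Some j))"
  shows "\<bar>first_order_term z y T j e'\<bar> \<le> taylor_evidence z y T j e' \<and>
    (\<forall>H U. open U \<longrightarrow> replacement_segment T j e' \<subseteq> U \<longrightarrow>
       twice_continuously_differentiable_on (unit_loss z y T j) U \<longrightarrow>
       (SUP v\<in>replacement_segment T j e'. spectral_norm (hessian (unit_loss z y T j) v)) \<le> H \<longrightarrow>
       \<bar>ceff_exact z y T j e'\<bar> \<le>
         taylor_evidence z y T j e' + H / 2 * (norm (direction T j e'))\<^sup>2)"
proof (intro conjI allI impI)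
  show "\<bar>first_order_term z y T j e'\<bar> \<le> taylor_evidence z y T j e'"
    by (rule abs_first_order_term_le)
next
  fix H U
  let ?f = "unit_loss z y T j" and ?e = "T $ Some j" and ?d = "direction T j e'"
    and ?S = "replacement_segment T j e'"
  assume sub: "?S \<subseteq> U" and C2: "twice_continuously_differentiable_on ?f U"
    and sup: "(SUP v\<in>?S. spectral_norm (hessian ?f v)) \<le> H"
  have S: "?S = (\<lambda>\<alpha>. ?e + \<alpha> *\<^sub>R ?d) ` {0..1}"
    by (auto simp: replacement_segment_def)
  have "compact ?S"
    unfolding S by (intro compact_continuous_image continuous_intros) simp
  moreover have "continuous_on ?S (hessian ?f)"
    using C2 sub continuous_on_subset by (auto simp: twice_continuously_differentiable_on_def)
  \<comment> \<open>On the reals \<open>SUP\<close> bounds its family only if the family is bounded above.\<close>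
  ultimately have bdd: "bdd_above ((\<lambda>v. spectral_norm (hessian ?f v)) ` ?S)"
    by (rule bdd_above_spectral_norm)
  have "\<bar>?f (?e + ?d) - ?f ?e - gradient ?f ?e \<bullet> ?d\<bar> \<le> H / 2 * (norm ?d)\<^sup>2"
  proof (rule first_order_taylor_bound[OF C2])
    fix t :: real
    assume "t \<in> {0..1}"
    then have t: "?e + t *\<^sub>R ?d \<in> ?S"
      unfolding S by blast
    then show "?e + t *\<^sub>R ?d \<in> U"
      using sub by blast
    show "spectral_norm (hessian ?f (?e + t *\<^sub>R ?d)) \<le> H"
      using cSUP_upper[OF t bdd] sup by linarith
  qed
  \<comment> \<open>Putting the original unit back restores \<open>T\<close>, which turns the exact
    effect into an increment of \<open>unit_loss\<close> from \<open>?e\<close> to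
    \<open>?e + ?d = e'\<close>.\<close>
  moreover have "replace_unit T j ?e = T"
    by (simp add: replace_unit_def vec_eq_iff)
  then have "ceff_exact z y T j e' = ?f (?e + ?d) - ?f ?e"
    by (simp add: ceff_exact_def unit_loss_def direction_def)
  ultimately show "\<bar>ceff_exact z y T j e'\<bar> \<le> taylor_evidence z y T j e' + H / 2 * (norm ?d)\<^sup>2"
    using abs_first_order_term_le[of z y T j e'] unfolding first_order_term_def by linarith
qed

end
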